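(* Let $F$ be a field. (a) Let $D$ be a central simple associative division algebra over $F$, $c\in D^\times$, $\sigma_1,\sigma_2,\sigma_3,\sigma_4\in\mathrm{Aut}_F(D)$ and $A_D=\mathrm{Cay}(D,c,\sigma_1,\sigma_2,\sigma_3,\sigma_4)$. Let $g,h\in\mathrm{Aut}_F(D)$ be such that $g\circ f=f\circ h$ for $f=\sigma_1,\sigma_2,\sigma_3^{-1},\sigma_4^{-1}$, and let $b\in F^\times$ be such that $g(c)=b^2c$. Then the map $G:A_D\to A_D$, $G(u,v)=(g(u),h(v)b)$, is an automorphism of $A_D$. (b) Let $K/F$ be a finite field extension, $c\in K^\times$, $\sigma_1,\sigma_2,\sigma_3,\sigma_4\in\mathrm{Aut}_F(K)$ and $A_K=\mathrm{Cay}(K,c,\sigma_1,\sigma_2,\sigma_3,\sigma_4)$. Let $g,h\in\mathrm{Aut}_F(K)$ be such that $g\circ f=f\circ h$ for $f=\sigma_1,\sigma_2,\sigma_3^{-1},\sigma_4^{-1}$, and let $b\in K^\times$ be such that $g(c)=\sigma_1(b)\sigma_2(b)c$. Then the map $G:A_K\to A_K$, $G(u,v)=(g(u),h(v)b)$, is an automorphism of $A_K$.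
   Context: For $E=D$ or $E=K$, $\mathrm{Cay}(E,c,\sigma_1,\sigma_2,\sigma_3,\sigma_4)$ denotes the $F$-vector space $E\oplus E$ with the (not necessarily associative) multiplication $(u,v)(x,y)=(ux+c\sigma_1(v)\sigma_2(y),\ \sigma_3(u)y+v\sigma_4(x))$. Automorphisms are $F$-algebra automorphisms. *)

theory Defs
  imports "HOL-Analysis.Product_Vector"
begin

text \<open>
  An algebra over a field \<open>'f\<close>, not necessarily associative or unital, is an abelian group
  \<open>'a\<close> with a scalar multiplication and a bilinear product. The product is passed as an
  argument, so that the same notions apply to the ring multiplication of a type and to the
  Cayley--Dickson-like products on \<open>'a \<times> 'a\<close>.
\<close>

locale nonassoc_algebra = vector_space sc
  for sc :: "'f::field \<Rightarrow> 'a::ab_group_add \<Rightarrow> 'a" +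
  fixes mult :: "'a \<Rightarrow> 'a \<Rightarrow> 'a"
  assumes mult_add_left: "mult (x + y) z = mult x z + mult y z"
    and mult_add_right: "mult x (y + z) = mult x y + mult x z"
    and mult_scale_left: "mult (sc a x) y = sc a (mult x y)"
    and mult_scale_right: "mult x (sc a y) = sc a (mult x y)"

definition alg_Aut :: "('f::field \<Rightarrow> 'a::ab_group_add \<Rightarrow> 'a) \<Rightarrow> ('a \<Rightarrow> 'a \<Rightarrow> 'a) \<Rightarrow> ('a \<Rightarrow> 'a) set"
  where "alg_Aut sc mult =
    {f. nonassoc_algebra sc mult \<and> Vector_Spaces.linear sc sc f \<and> bij f \<and>
        (\<forall>x y. f (mult x y) = mult (f x) (f y))}"

text \<open>
  Associativity, the unit and \<open>1 \<noteq> 0\<close> come from the type class \<^class>\<open>ring_1\<close>. The base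
  field is embedded by \<open>\<lambda>a. sc a 1\<close>.
\<close>

locale finite_dim_assoc_algebra = nonassoc_algebra sc "(*)"
  for sc :: "'f::field \<Rightarrow> 'a::ring_1 \<Rightarrow> 'a" +
  assumes finite_dim: "\<exists>B. finite B \<and> module.span sc B = UNIV"

definition two_sided_ideal :: "'a::ring_1 set \<Rightarrow> bool"
  where "two_sided_ideal I \<longleftrightarrow>
    0 \<in> I \<and> (\<forall>x\<in>I. \<forall>y\<in>I. x - y \<in> I) \<and> (\<forall>x\<in>I. \<forall>r. r * x \<in> I \<and> x * r \<in> I)"

locale central_simple_algebra = finite_dim_assoc_algebra sc
  for sc :: "'f::field \<Rightarrow> 'a::ring_1 \<Rightarrow> 'a" +
  assumes central: "{z. \<forall>x. z * x = x * z} = range (\<lambda>a. sc a 1)"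
    and simple: "two_sided_ideal (I::'a set) \<Longrightarrow> I = {0} \<or> I = UNIV"

text \<open>
  A finite extension of \<open>'f\<close> is a field type carrying the structure of a finite-dimensional
  algebra over \<open>'f\<close>; the embedding \<open>\<lambda>a. sc a 1\<close> is then an injective ring homomorphism.
\<close>

locale finite_field_extension = finite_dim_assoc_algebra sc
  for sc :: "'f::field \<Rightarrow> 'k::field \<Rightarrow> 'k"

fun cay_mult ::
    "'a::ring_1 \<Rightarrow> ('a \<Rightarrow> 'a) \<Rightarrow> ('a \<Rightarrow> 'a) \<Rightarrow> ('a \<Rightarrow> 'a) \<Rightarrow> ('a \<Rightarrow> 'a) \<Rightarrow>
     'a \<times> 'a \<Rightarrow> 'a \<times> 'a \<Rightarrow> 'a \<times> 'a"
  where "cay_mult c \<sigma>1 \<sigma>2 \<sigma>3 \<sigma>4 (u, v) (x, y) = (u * x + c * \<sigma>1 v * \<sigma>2 y, \<sigma>3 u * y + v * \<sigma>4 x)"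

abbreviation cay_scale :: "('f::field \<Rightarrow> 'a::ring_1 \<Rightarrow> 'a) \<Rightarrow> 'f \<Rightarrow> 'a \<times> 'a \<Rightarrow> 'a \<times> 'a"
  where "cay_scale sc \<equiv> module_prod.scale sc sc"

end

theory Submission
  imports Defs
begin

text \<open>
  Both parts are one computation. Over a field every \<open>b\<close> is central, and over a central simple
  algebra a scalar \<open>b\<close> acts as multiplication by the central unit \<open>b1\<close>, which every
  \<open>F\<close>-automorphism fixes, so that \<open>\<sigma>1(b1) \<sigma>2(b1) c = b\<^sup>2 c\<close>. It therefore suffices to treat an
  arbitrary unital associative \<open>F\<close>-algebra \<open>A\<close> and a central unit \<open>b\<close> of \<open>A\<close> with
  \<open>g(c) = \<sigma>1(b) \<sigma>2(b) c\<close>.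

  There, the map \<open>(u, v) \<mapsto> (g u, h(v) b)\<close> is multiplicative for the following reason. The relations
  \<open>g \<circ> \<sigma>1 = \<sigma>1 \<circ> h\<close> and \<open>g \<circ> \<sigma>2 = \<sigma>2 \<circ> h\<close> turn the first component of the image of a product into
  \<open>g(u) g(x) + g(c) \<sigma>1(h v) \<sigma>2(h y)\<close>; since automorphisms preserve the centre, the factors
  \<open>\<sigma>1(b)\<close>, \<open>\<sigma>2(b)\<close> of \<open>g(c)\<close> can be moved next to \<open>\<sigma>1(h v)\<close> and \<open>\<sigma>2(h y)\<close>. The relations for
  \<open>\<sigma>3\<inverse>\<close> and \<open>\<sigma>4\<inverse>\<close> say that \<open>h \<circ> \<sigma>3 = \<sigma>3 \<circ> g\<close> and \<open>h \<circ> \<sigma>4 = \<sigma>4 \<circ> g\<close>, which is what the second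
  component needs. Bijectivity holds because \<open>g\<close>, \<open>h\<close> and multiplication by the unit \<open>b\<close> are
  bijective.
\<close>

lemma alg_AutD:
  assumes "f \<in> alg_Aut sc mult"
  shows "bij f" "f (x + y) = f x + f y" "f (sc a x) = sc a (f x)" "f (mult x y) = mult (f x) (f y)"
  using assms by (auto simp: alg_Aut_def Vector_Spaces.linear_iff)

text \<open>
  Surjectivity is essential: multiplicativity alone only makes \<open>f 1\<close> idempotent, but \<open>f 1\<close> is a
  left unit on the range of \<open>f\<close>, hence on \<open>1\<close>.
\<close>

lemma alg_Aut_one:
  fixes f :: "'a::ring_1 \<Rightarrow> 'a"
  assumes "f \<in> alg_Aut sc (*)"
  shows "f 1 = 1"
proof -
  obtain z where z: "f z = 1"
    using alg_AutD(1)[OF assms] by (metis bij_pointE)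
  have "f 1 = f 1 * f z" by (simp add: z)
  also have "\<dots> = f (1 * z)" by (simp only: alg_AutD(4)[OF assms])
  finally show ?thesis by (simp add: z)
qed

text \<open>
  The image of \<open>b\<close> commutes with the range of \<open>f\<close>, which is everything.
\<close>

lemma alg_Aut_preserves_center:
  fixes f :: "'a::ring_1 \<Rightarrow> 'a"
  assumes f: "f \<in> alg_Aut sc (*)" and b: "\<And>x. b * x = x * b"
  shows "f b * y = y * f b"
proof -
  obtain x where "y = f x"
    using alg_AutD(1)[OF f] by (metis bij_pointE)
  then show ?thesis
    using b by (metis alg_AutD(4)[OF f])
qed

text \<open>
  Composing \<open>g \<circ> s\<inverse> = s\<inverse> \<circ> h\<close> with \<open>s\<close> on both sides exchanges the positions of \<open>g\<close> and \<open>h\<close>.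
\<close>

lemma intertwines_inv_imp:
  assumes "bij s" and "g \<circ> inv s = inv s \<circ> h"
  shows "h (s x) = s (g x)"
proof -
  have "inv s (h (s x)) = g (inv s (s x))"
    using assms(2) by (metis comp_apply)
  then have "inv s (h (s x)) = g x"
    using assms(1) by (simp add: bij_is_inj)
  then show ?thesis
    using assms(1) by (metis bij_inv_eq_iff)
qed

text \<open>
  Belonging to \<^const>\<open>alg_Aut\<close> includes that the product is bilinear. The
  \<open>F\<close>-linearity of the \<open>\<sigma>i\<close> gives this; semilinear ring automorphisms would not.
\<close>

lemma nonassoc_algebra_cay:
  fixes sc :: "'f::field \<Rightarrow> 'a::ring_1 \<Rightarrow> 'a"
  assumes alg: "nonassoc_algebra sc (*)"
    and \<sigma>: "{\<sigma>1, \<sigma>2, \<sigma>3, \<sigma>4} \<subseteq> alg_Aut sc (*)"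
  shows "nonassoc_algebra (cay_scale sc) (cay_mult c \<sigma>1 \<sigma>2 \<sigma>3 \<sigma>4)"
proof -
  interpret A: nonassoc_algebra sc "(*)" by fact
  interpret P: vector_space_prod sc sc ..
  note [simp] = alg_AutD(2,3)[of \<sigma>1 sc "(*)"] alg_AutD(2,3)[of \<sigma>2 sc "(*)"]
    alg_AutD(2,3)[of \<sigma>3 sc "(*)"] alg_AutD(2,3)[of \<sigma>4 sc "(*)"]
  show ?thesis
  proof (unfold_locales, goal_cases)
    case (1 x y z)
    then show ?case using \<sigma>
      by (cases x; cases y; cases z) (simp add: algebra_simps)
  next
    case (2 x y z)
    then show ?case using \<sigma>
      by (cases x; cases y; cases z) (simp add: algebra_simps)
  next
    case (3 a x y)
    then show ?case using \<sigma>
      by (cases x; cases y)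
        (simp add: P.scale_def A.scale_right_distrib A.mult_scale_left A.mult_scale_right)
  next
    case (4 x a y)
    then show ?case using \<sigma>
      by (cases x; cases y)
        (simp add: P.scale_def A.scale_right_distrib A.mult_scale_left A.mult_scale_right)
  qed
qed

text \<open>
  The statement common to both parts. A two-sided inverse \<open>b'\<close> of \<open>b\<close> is given explicitly since a
  general ring has no inverse operation.
\<close>

lemma cay_automorphism_central_unit:
  fixes sc :: "'f::field \<Rightarrow> 'a::ring_1 \<Rightarrow> 'a"
  assumes alg: "nonassoc_algebra sc (*)"
    and \<sigma>: "{\<sigma>1, \<sigma>2, \<sigma>3, \<sigma>4} \<subseteq> alg_Aut sc (*)"
    and gh: "{g, h} \<subseteq> alg_Aut sc (*)"
    and comm: "\<forall>f\<in>{\<sigma>1, \<sigma>2, inv \<sigma>3, inv \<sigma>4}. g \<circ> f = f \<circ> h"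
    and central: "\<And>x. b * x = x * b"
    and unit: "b * b' = 1" "b' * b = 1"
    and gc: "g c = \<sigma>1 b * \<sigma>2 b * c"
  shows "(\<lambda>(u, v). (g u, h v * b)) \<in> alg_Aut (cay_scale sc) (cay_mult c \<sigma>1 \<sigma>2 \<sigma>3 \<sigma>4)"
proof -
  interpret A: nonassoc_algebra sc "(*)" by fact
  interpret P: vector_space_prod sc sc ..
  interpret C: nonassoc_algebra "cay_scale sc" "cay_mult c \<sigma>1 \<sigma>2 \<sigma>3 \<sigma>4"
    using alg \<sigma> by (rule nonassoc_algebra_cay)
  have s: "\<sigma>1 \<in> alg_Aut sc (*)" "\<sigma>2 \<in> alg_Aut sc (*)" "\<sigma>3 \<in> alg_Aut sc (*)"
    "\<sigma>4 \<in> alg_Aut sc (*)" and g: "g \<in> alg_Aut sc (*)" and h: "h \<in> alg_Aut sc (*)"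
    using \<sigma> gh by auto
  have c12: "g (\<sigma>1 x) = \<sigma>1 (h x)" "g (\<sigma>2 x) = \<sigma>2 (h x)" for x
    using comm by (simp_all add: fun_eq_iff)
  have c34: "h (\<sigma>3 x) = \<sigma>3 (g x)" "h (\<sigma>4 x) = \<sigma>4 (g x)" for x
    using comm alg_AutD(1)[OF s(3)] alg_AutD(1)[OF s(4)]
    by (auto intro: intertwines_inv_imp)
  let ?G = "\<lambda>(u, v). (g u, h v * b)"
  have lin: "Vector_Spaces.linear (cay_scale sc) (cay_scale sc) ?G"
    unfolding Vector_Spaces.linear_iff
    using P.p.vector_space_axioms
    by (auto simp: P.scale_def alg_AutD(2,3)[OF g] alg_AutD(2,3)[OF h] A.mult_scale_left
        distrib_right)
  have bij_mult: "bij (\<lambda>v. v * b)"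
    by (rule bij_betw_byWitness[where f' = "\<lambda>v. v * b'"]) (auto simp: mult.assoc unit)
  have "bij (\<lambda>v. h v * b)"
    using bij_comp[OF alg_AutD(1)[OF h] bij_mult] by (simp add: comp_def)
  then have "bij (map_prod g (\<lambda>v. h v * b))"
    using alg_AutD(1)[OF g] bij_betw_map_prod[of g UNIV UNIV "\<lambda>v. h v * b" UNIV UNIV] by simp
  then have bij: "bij ?G"
    by (simp add: map_prod_def)
  have "?G (cay_mult c \<sigma>1 \<sigma>2 \<sigma>3 \<sigma>4 (u, v) (x, y)) =
        cay_mult c \<sigma>1 \<sigma>2 \<sigma>3 \<sigma>4 (?G (u, v)) (?G (x, y))" for u v x y
  proof -
    (* Both factors coming from g c are central, being images of b under automorphisms. *)
    have "\<sigma>1 b * \<sigma>2 b * c * \<sigma>1 (h v) * \<sigma>2 (h y) = c * \<sigma>1 (h v * b) * \<sigma>2 (h y * b)"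
      using alg_Aut_preserves_center[OF s(1) central] alg_Aut_preserves_center[OF s(2) central]
      unfolding alg_AutD(4)[OF s(1)] alg_AutD(4)[OF s(2)] by (metis mult.assoc)
    moreover have "h v * \<sigma>4 (g x) * b = h v * b * \<sigma>4 (g x)"
      by (simp add: mult.assoc central)
    ultimately show ?thesis
      by (simp add: alg_AutD(2,4)[OF g] alg_AutD(2,4)[OF h] gc c12 c34 distrib_right mult.assoc)
  qed
  then show ?thesis
    using C.nonassoc_algebra_axioms lin bij unfolding alg_Aut_def by auto
qed

theorem theorem2p15:
  fixes scaleD :: "'f::field \<Rightarrow> 'd::division_ring \<Rightarrow> 'd"
    and scaleK :: "'f \<Rightarrow> 'k::field \<Rightarrow> 'k"
  shows
    "(central_simple_algebra scaleD \<longrightarrow>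
       (\<forall>(c::'d) \<sigma>1 \<sigma>2 \<sigma>3 \<sigma>4 g h (b::'f).
          c \<noteq> 0 \<and> {\<sigma>1, \<sigma>2, \<sigma>3, \<sigma>4} \<subseteq> alg_Aut scaleD (*) \<and>
          {g, h} \<subseteq> alg_Aut scaleD (*) \<and>
          (\<forall>f\<in>{\<sigma>1, \<sigma>2, inv \<sigma>3, inv \<sigma>4}. g \<circ> f = f \<circ> h) \<and>
          b \<noteq> 0 \<and> g c = scaleD (b\<^sup>2) c \<longrightarrow>
          (\<lambda>(u, v). (g u, scaleD b (h v)))
            \<in> alg_Aut (cay_scale scaleD) (cay_mult c \<sigma>1 \<sigma>2 \<sigma>3 \<sigma>4)))
     \<and>
     (finite_field_extension scaleK \<longrightarrow>
       (\<forall>(c::'k) \<sigma>1 \<sigma>2 \<sigma>3 \<sigma>4 g h (b::'k).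
          c \<noteq> 0 \<and> {\<sigma>1, \<sigma>2, \<sigma>3, \<sigma>4} \<subseteq> alg_Aut scaleK (*) \<and>
          {g, h} \<subseteq> alg_Aut scaleK (*) \<and>
          (\<forall>f\<in>{\<sigma>1, \<sigma>2, inv \<sigma>3, inv \<sigma>4}. g \<circ> f = f \<circ> h) \<and>
          b \<noteq> 0 \<and> g c = \<sigma>1 b * \<sigma>2 b * c \<longrightarrow>
          (\<lambda>(u, v). (g u, h v * b))
            \<in> alg_Aut (cay_scale scaleK) (cay_mult c \<sigma>1 \<sigma>2 \<sigma>3 \<sigma>4)))"
proof (intro conjI impI allI; elim conjE)
  fix c :: 'd and \<sigma>1 \<sigma>2 \<sigma>3 \<sigma>4 g h and b :: 'f
  assume csa: "central_simple_algebra scaleD"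
    and auts: "{\<sigma>1, \<sigma>2, \<sigma>3, \<sigma>4} \<subseteq> alg_Aut scaleD (*)" "{g, h} \<subseteq> alg_Aut scaleD (*)"
    and comm: "\<forall>f\<in>{\<sigma>1, \<sigma>2, inv \<sigma>3, inv \<sigma>4}. g \<circ> f = f \<circ> h"
    and b: "b \<noteq> 0" and gc: "g c = scaleD (b\<^sup>2) c"
  interpret D: central_simple_algebra scaleD by fact
  have "\<sigma> (scaleD b 1) = scaleD b 1" if "\<sigma> \<in> alg_Aut scaleD (*)" for \<sigma>
    by (simp add: alg_AutD(3)[OF that] alg_Aut_one[OF that])
  then have fixed: "\<sigma>1 (scaleD b 1) = scaleD b 1" "\<sigma>2 (scaleD b 1) = scaleD b 1"
    using auts by auto
  have "(\<lambda>(u, v). (g u, h v * scaleD b 1))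
      \<in> alg_Aut (cay_scale scaleD) (cay_mult c \<sigma>1 \<sigma>2 \<sigma>3 \<sigma>4)"
    by (rule cay_automorphism_central_unit[OF D.nonassoc_algebra_axioms auts comm,
          where b' = "scaleD (inverse b) 1"])
      (simp_all add: fixed gc b D.mult_scale_left D.mult_scale_right power2_eq_square)
  then show "(\<lambda>(u, v). (g u, scaleD b (h v)))
      \<in> alg_Aut (cay_scale scaleD) (cay_mult c \<sigma>1 \<sigma>2 \<sigma>3 \<sigma>4)"
    by (simp add: D.mult_scale_right)
next
  fix c :: 'k and \<sigma>1 \<sigma>2 \<sigma>3 \<sigma>4 g h and b :: 'k
  assume ext: "finite_field_extension scaleK"
    and auts: "{\<sigma>1, \<sigma>2, \<sigma>3, \<sigma>4} \<subseteq> alg_Aut scaleK (*)" "{g, h} \<subseteq> alg_Aut scaleK (*)"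
    and comm: "\<forall>f\<in>{\<sigma>1, \<sigma>2, inv \<sigma>3, inv \<sigma>4}. g \<circ> f = f \<circ> h"
    and b: "b \<noteq> 0" and gc: "g c = \<sigma>1 b * \<sigma>2 b * c"
  interpret K: finite_field_extension scaleK by fact
  show "(\<lambda>(u, v). (g u, h v * b)) \<in> alg_Aut (cay_scale scaleK) (cay_mult c \<sigma>1 \<sigma>2 \<sigma>3 \<sigma>4)"
    by (rule cay_automorphism_central_unit[OF K.nonassoc_algebra_axioms auts comm _ _ _ gc,
          where b' = "inverse b"]) (simp_all add: b)
qed

end
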